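(* For $\gamma\in(0,1]$ let $\mathcal S(\gamma)=\{j\in\mathcal J:\underline v_j/\overline v_j<e^{-1/\gamma}\}$, and let $\gamma^*\in(0,1]$ be the unique solution of $$\phi(\gamma)=\gamma e^{-1/\gamma}\sum_{j\in \mathcal S(\gamma)} \overline v_j-\sum_{j\in\mathcal J\setminus \mathcal S(\gamma)}\underline v_j\big(\gamma\ln(\underline v_j/\overline v_j)-\gamma+1\big)=0.$$ Then the mechanism $M_{\gamma^*}$ achieves an approximation ratio of $\gamma^*$, i.e. $$\min_{\boldsymbol v\in\mathcal V}\frac{t^{M_{\gamma^*}}(\boldsymbol v)}{\boldsymbol 1^\top\boldsymbol v}=\gamma^*,$$ where $t^{M_{\gamma^*}}$ is the payment rule of $M_{\gamma^*}$.
   Context: Setting. $\mathcal J=\{1,\dots,J\}$ is a finite set of products with bounds $0\le\underline v_j\le\overline v_j<\infty$, $\overline v_j>0$ for all $j$, and $\max_j\underline v_j>0$. $\mathcal V=\prod_{j\in\mathcal J}[\underline v_j,\overline v_j]$; $\boldsymbol 1$ is the all-ones vector. Mechanism $M_\gamma=(\boldsymbol q,t)$ ($\gamma\in(0,1]$): $\boldsymbol q(\boldsymbol v)=(q_1(v_1),\dots,q_J(v_J))$ with $q_j(v_j)=(\gamma\ln(v_j/\overline v_j)+1)^+$ (convention $\ln 0=-\infty$, $x^+=\max\{x,0\}$), and payment rule $t(\boldsymbol v)=\sum_j t_j(v_j)$ with $t_j(v_j)=\gamma\,(v_j-e^{-1/\gamma}\overline v_j)^+$ if $e^{-1/\gamma}\overline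 v_j>\underline v_j$, and $t_j(v_j)=\gamma v_j+\underline v_j\big(\gamma(\ln(\underline v_j/\overline v_j)-1)+1\big)$ if $e^{-1/\gamma}\overline v_j\le\underline v_j$. *)

theory Defs
  imports "HOL-Analysis.Analysis"
begin

text \<open>
  The products are the elements of the index type \<open>'n\<close>; \<open>lo\<close> and \<open>up\<close> are the vectors of lower and
  upper bounds. The set of valuation profiles is the box \<open>cbox lo up\<close>, and the all-ones vector is
  the constant \<open>1\<close> of type \<open>real ^ 'n\<close>.
\<close>

type_synonym 'n mechanism = "(real ^ 'n \<Rightarrow> real ^ 'n) \<times> (real ^ 'n \<Rightarrow> real)"

abbreviation allocation :: "'n mechanism \<Rightarrow> real ^ 'n \<Rightarrow> real ^ 'n" where
  "allocation M \<equiv> fst M"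

abbreviation payment :: "'n mechanism \<Rightarrow> real ^ 'n \<Rightarrow> real" where
  "payment M \<equiv> snd M"

text \<open>
  The case \<open>x = 0\<close> encodes the convention that the logarithm of 0 is minus infinity (the library
  has \<open>ln 0 = 0\<close>). In \<open>pay_component\<close> and \<open>phi\<close> no such case is needed: for \<open>u > 0\<close>, the logarithm
  is only taken in the case \<open>l \<ge> exp (- 1 / \<gamma>) * u > 0\<close>.
\<close>

definition alloc_component :: "real \<Rightarrow> real \<Rightarrow> real \<Rightarrow> real" where
  "alloc_component \<gamma> u x = (if x = 0 then 0 else max (\<gamma> * ln (x / u) + 1) 0)"

definition pay_component :: "real \<Rightarrow> real \<Rightarrow> real \<Rightarrow> real \<Rightarrow> real" where
  "pay_component \<gamma> l u x =
     (if exp (- 1 / \<gamma>) * u > l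
      then \<gamma> * max (x - exp (- 1 / \<gamma>) * u) 0
      else \<gamma> * x + l * (\<gamma> * (ln (l / u) - 1) + 1))"

definition mech :: "real ^ 'n \<Rightarrow> real ^ 'n \<Rightarrow> real \<Rightarrow> 'n::finite mechanism" where
  "mech lo up \<gamma> =
     ((\<lambda>v. \<chi> j. alloc_component \<gamma> (up $ j) (v $ j)),
      (\<lambda>v. \<Sum>j\<in>UNIV. pay_component \<gamma> (lo $ j) (up $ j) (v $ j)))"

definition S_set :: "real ^ 'n \<Rightarrow> real ^ 'n \<Rightarrow> real \<Rightarrow> 'n::finite set" where
  "S_set lo up \<gamma> = {j. lo $ j / up $ j < exp (- 1 / \<gamma>)}"

definition phi :: "real ^ 'n::finite \<Rightarrow> real ^ 'n \<Rightarrow> real \<Rightarrow> real" where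
  "phi lo up \<gamma> =
     \<gamma> * exp (- 1 / \<gamma>) * (\<Sum>j\<in>S_set lo up \<gamma>. up $ j)
     - (\<Sum>j\<in>UNIV - S_set lo up \<gamma>. lo $ j * (\<gamma> * ln (lo $ j / up $ j) - \<gamma> + 1))"

text \<open>The minimum is required to be attained, so it is not expressed by \<open>Inf\<close>.\<close>

definition is_minimum :: "real \<Rightarrow> real set \<Rightarrow> bool" where
  "is_minimum m A \<longleftrightarrow> m \<in> A \<and> (\<forall>a\<in>A. m \<le> a)"

definition achieves_approximation_ratio ::
    "real ^ 'n \<Rightarrow> real ^ 'n \<Rightarrow> 'n::finite mechanism \<Rightarrow> real \<Rightarrow> bool" where
  "achieves_approximation_ratio lo up M r \<longleftrightarrow>
     is_minimum r ((\<lambda>v. payment M v / (1 \<bullet> v)) ` cbox lo up)"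

end

theory Submission
  imports Defs
begin

text \<open>
  Write \<open>m\<^sub>j = max lo\<^sub>j (exp (-1/\<gamma>) up\<^sub>j)\<close> and \<open>f\<^sub>j(\<gamma>) = m\<^sub>j (\<gamma> - 1 - \<gamma> ln (m\<^sub>j / up\<^sub>j))\<close>. Both cases of the
  definition of \<open>phi\<close> are then covered by \<open>phi = \<Sum>\<^sub>j f\<^sub>j\<close>, and the payments satisfy
  \<open>t\<^sub>j(x) \<ge> \<gamma> x - f\<^sub>j(\<gamma>)\<close> with equality at \<open>x = up\<^sub>j\<close>. Hence at a root of \<open>phi\<close> the total payment is at
  least \<open>\<gamma>\<close> times the total value, with equality at the profile of upper bounds.
  The root is unique because \<open>f\<^sub>j(\<gamma>)\<close> is the maximum over \<open>x \<ge> lo\<^sub>j\<close> of \<open>x (\<gamma> - 1 - \<gamma> ln (x / up\<^sub>j))\<close>,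
  which is strictly increasing in \<open>\<gamma>\<close> for each \<open>0 < x \<le> up\<^sub>j\<close>; it exists by the intermediate value
  theorem, as \<open>phi(1) \<ge> 0\<close> and \<open>phi(\<gamma>) \<le> \<gamma> \<Sum>\<^sub>j up\<^sub>j - \<Sum>\<^sub>j lo\<^sub>j\<close>.
\<close>

text \<open>For \<gamma>, \<open>u\<close> > 0 this is the maximizer of
  \<open>x * (\<gamma> - 1 - \<gamma> * ln (x / u))\<close> over positive \<open>x\<close> \<ge>
  \<open>l\<close>: the derivative \<open>- 1 - \<gamma> * ln (x / u)\<close> changes sign at
  \<open>exp (- 1 / \<gamma>) * u\<close>.\<close>

definition threshold :: "real \<Rightarrow> real \<Rightarrow> real \<Rightarrow> real" where
  "threshold l u \<gamma> = max l (exp (- 1 / \<gamma>) * u)"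

text \<open>The corresponding maximum; it is also the gap between \<open>\<gamma> * u\<close> and
  the payment at the upper bound \<open>u\<close>.\<close>

definition slack :: "real \<Rightarrow> real \<Rightarrow> real \<Rightarrow> real" where
  "slack l u \<gamma> = threshold l u \<gamma> * (\<gamma> - 1 - \<gamma> * ln (threshold l u \<gamma> / u))"

lemma threshold_pos: "0 < u \<Longrightarrow> 0 < threshold l u \<gamma>"
  by (simp add: threshold_def less_max_iff_disj)

lemma threshold_le: "0 < u \<Longrightarrow> l \<le> u \<Longrightarrow> 0 < \<gamma> \<Longrightarrow> threshold l u \<gamma> \<le> u"
  by (simp add: threshold_def)

lemma slack_below:
  assumes "l < exp (- 1 / \<gamma>) * u" "0 < u" "0 < \<gamma>"
  shows "slack l u \<gamma> = \<gamma> * exp (- 1 / \<gamma>) * u"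
  using assms by (simp add: slack_def threshold_def max_def)

lemma slack_above:
  assumes "exp (- 1 / \<gamma>) * u \<le> l"
  shows "slack l u \<gamma> = - l * (\<gamma> * ln (l / u) - \<gamma> + 1)"
  using assms by (simp add: slack_def threshold_def max_absorb1 algebra_simps)

lemma phi_eq_sum_slack:
  fixes lo up :: "real ^ 'n::finite"
  assumes "\<forall>j. 0 < up $ j" "0 < \<gamma>"
  shows "phi lo up \<gamma> = (\<Sum>j\<in>UNIV. slack (lo $ j) (up $ j) \<gamma>)"
proof -
  let ?S = "S_set lo up \<gamma>"
  have S: "j \<in> ?S \<longleftrightarrow> lo $ j < exp (- 1 / \<gamma>) * up $ j" for j
    using assms by (simp add: S_set_def pos_divide_less_eq)
  have "(\<Sum>j\<in>UNIV. slack (lo $ j) (up $ j) \<gamma>) =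
      (\<Sum>j\<in>UNIV - ?S. slack (lo $ j) (up $ j) \<gamma>) + (\<Sum>j\<in>?S. slack (lo $ j) (up $ j) \<gamma>)"
    by (rule sum.subset_diff) auto
  also have "(\<Sum>j\<in>?S. slack (lo $ j) (up $ j) \<gamma>) = (\<Sum>j\<in>?S. \<gamma> * exp (- 1 / \<gamma>) * up $ j)"
    using assms by (intro sum.cong refl slack_below) (auto simp: S)
  also have "(\<Sum>j\<in>UNIV - ?S. slack (lo $ j) (up $ j) \<gamma>) =
      (\<Sum>j\<in>UNIV - ?S. - lo $ j * (\<gamma> * ln (lo $ j / up $ j) - \<gamma> + 1))"
    by (intro sum.cong refl slack_above) (auto simp: S)
  finally show ?thesis
    by (simp add: phi_def sum_distrib_left sum_negf)
qed

text \<open>Envelope argument: keep the maximizer \<open>m\<close> for \<gamma> fixed, raise the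
  parameter to \<gamma>', and bound the value at \<open>m\<close> by the maximum for
  \<gamma>'.\<close>

lemma slack_strict_mono:
  assumes u: "0 < u" "l \<le> u" and \<gamma>: "0 < \<gamma>" "\<gamma> < \<gamma>'"
  shows "slack l u \<gamma> < slack l u \<gamma>'"
proof -
  define m where "m = threshold l u \<gamma>"
  have m: "0 < m" "m \<le> u" "l \<le> m"
    using threshold_pos[of u l \<gamma>] threshold_le[of u l \<gamma>] u \<gamma>
    by (auto simp: m_def threshold_def)
  have "ln (m / u) \<le> 0"
    using m u by simp
  then have "0 < (\<gamma>' - \<gamma>) * (1 - ln (m / u))"
    using \<gamma> by simp
  then have "m * (\<gamma> - 1 - \<gamma> * ln (m / u)) < m * (\<gamma>' - 1 - \<gamma>' * ln (m / u))"
    using m by (intro mult_strict_left_mono) (auto simp: algebra_simps)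
  also have "\<dots> \<le> slack l u \<gamma>'"
  proof (cases "l < exp (- 1 / \<gamma>') * u")
    case True
    \<comment> \<open>Here \<open>c\<close> is the unconstrained maximizer for \<gamma>'; its
      optimality over \<open>m\<close> reduces to 1 + ln y \<le> y at y =
      \<open>c / m\<close>.\<close>
    define c where "c = exp (- 1 / \<gamma>') * u"
    have c: "0 < c" using u by (simp add: c_def)
    have ln_eq: "ln (m / u) = - 1 / \<gamma>' - ln (c / m)"
      using m u by (simp add: c_def ln_div ln_mult)
    then have "m * (\<gamma>' - 1 - \<gamma>' * ln (m / u)) = m * \<gamma>' * (1 + ln (c / m))"
      unfolding ln_eq using \<gamma> by (simp add: field_simps)
    also have "\<dots> \<le> m * \<gamma>' * (c / m)"
      using m c \<gamma> ln_le_minus_one[of "c / m"] by (intro mult_left_mono) auto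
    also have "\<dots> = slack l u \<gamma>'"
      using slack_below[OF True] u \<gamma> m by (simp add: c_def)
    finally show ?thesis .
  next
    case False
    \<comment> \<open>The unconstrained maximizer grows with the parameter, so \<open>l\<close> is
      the maximizer for both parameters.\<close>
    have "exp (- 1 / \<gamma>) * u \<le> exp (- 1 / \<gamma>') * u"
      using u \<gamma> by (auto simp: field_simps)
    then have "m = l" "threshold l u \<gamma>' = l"
      using False by (auto simp: m_def threshold_def)
    then show ?thesis
      by (simp add: slack_def)
  qed
  finally show ?thesis
    by (simp add: slack_def m_def)
qed

text \<open>The maximum in \<open>threshold\<close> joins the two cases continuously and keeps the
  argument of \<open>ln\<close> positive even for \<open>l = 0\<close>.\<close>

lemma continuous_on_slack:
  assumes "0 < u"
  shows "continuous_on {0<..} (slack l u)"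
proof -
  have "continuous_on {0<..} (threshold l u)"
    unfolding threshold_def by (auto intro!: continuous_intros)
  then show ?thesis
    unfolding slack_def using threshold_pos[OF assms]
    by (auto intro!: continuous_intros simp: assms less_imp_neq[symmetric])
qed

text \<open>From ln y \<le> y - 1 at y = \<open>u / m\<close>, followed by \<open>l\<close> \<le>
  \<open>m\<close>.\<close>

lemma slack_le:
  assumes "0 < u" "0 < \<gamma>"
  shows "slack l u \<gamma> \<le> \<gamma> * u - l"
proof -
  define m where "m = threshold l u \<gamma>"
  have m: "0 < m" "l \<le> m"
    using threshold_pos[OF assms(1)] by (auto simp: m_def threshold_def)
  have "- ln (m / u) \<le> u / m - 1"
    using ln_le_minus_one[of "u / m"] m assms by (simp add: ln_div)
  then have "\<gamma> * - ln (m / u) \<le> \<gamma> * (u / m - 1)"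
    using assms by (intro mult_left_mono) auto
  then have "m * (\<gamma> - 1 - \<gamma> * ln (m / u)) \<le> m * (\<gamma> - 1 + \<gamma> * (u / m - 1))"
    using m by (intro mult_left_mono) auto
  also have "\<dots> = \<gamma> * u - m"
    using m by (simp add: field_simps)
  finally show ?thesis
    using m by (simp add: slack_def m_def)
qed

lemma slack_one_nonneg:
  assumes "0 < u" "l \<le> u"
  shows "0 \<le> slack l u 1"
proof -
  have "ln (threshold l u 1 / u) \<le> 0"
    using threshold_pos[of u l 1] threshold_le[of u l 1] assms by simp
  then show ?thesis
    using threshold_pos[of u l 1] assms by (simp add: slack_def mult_nonneg_nonpos)
qed

text \<open>Equality holds in the affine case; otherwise the only loss comes from dropping the
  truncation at 0.\<close>

lemma pay_component_ge:
  assumes "0 < u" "0 < \<gamma>"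
  shows "\<gamma> * x - slack l u \<gamma> \<le> pay_component \<gamma> l u x"
proof (cases "l < exp (- 1 / \<gamma>) * u")
  case True
  have "\<gamma> * (x - exp (- 1 / \<gamma>) * u) \<le> \<gamma> * max (x - exp (- 1 / \<gamma>) * u) 0"
    using assms by (intro mult_left_mono) auto
  then show ?thesis
    using True assms slack_below[OF True] by (simp add: pay_component_def algebra_simps)
next
  case False
  then show ?thesis
    using slack_above[of \<gamma> u l] by (simp add: pay_component_def algebra_simps)
qed

lemma pay_component_upper:
  assumes "0 < u" "0 < \<gamma>"
  shows "pay_component \<gamma> l u u = \<gamma> * u - slack l u \<gamma>"
proof (cases "l < exp (- 1 / \<gamma>) * u")
  case True
  have "exp (- 1 / \<gamma>) * u \<le> u"
    using assms by simp
  then show ?thesis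
    using True assms slack_below[OF True] by (simp add: pay_component_def algebra_simps)
next
  case False
  then show ?thesis
    using slack_above[of \<gamma> u l] by (simp add: pay_component_def algebra_simps)
qed

lemma one_inner_vec: "1 \<bullet> v = (\<Sum>j\<in>UNIV. v $ j)" for v :: "real ^ 'n::finite"
  by (simp add: inner_vec_def)

text \<open>An index attaining the maximum of \<open>lo\<close> contributes a positive term. This
  makes the ratio's denominator positive and, for \<open>v = lo\<close>, the left end of the
  interval in the root search.\<close>

lemma sum_vec_pos:
  fixes lo v :: "real ^ 'n::finite"
  assumes "\<forall>j. 0 \<le> lo $ j" "0 < Max (range (\<lambda>j. lo $ j))" "\<forall>j. lo $ j \<le> v $ j"
  shows "0 < (\<Sum>j\<in>UNIV. v $ j)"
proof -
  have "Max (range (\<lambda>j. lo $ j)) \<in> range (\<lambda>j. lo $ j)"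
    by (rule Max_in) auto
  then obtain k where "Max (range (\<lambda>j. lo $ j)) = lo $ k"
    by blast
  then have "0 < lo $ k"
    using assms(2) by simp
  then have "0 < v $ k"
    using assms(3) less_le_trans by blast
  then show ?thesis
    using assms(1,3) by (intro sum_pos2[of _ k]) (auto intro: order_trans)
qed

lemma mech_achieves_root:
  fixes lo up :: "real ^ 'n::finite"
  assumes bounds: "\<forall>j. 0 \<le> lo $ j \<and> lo $ j \<le> up $ j"
    and up: "\<forall>j. 0 < up $ j"
    and lo: "0 < Max (range (\<lambda>j. lo $ j))"
    and \<gamma>: "0 < \<gamma>" and root: "phi lo up \<gamma> = 0"
  shows "achieves_approximation_ratio lo up (mech lo up \<gamma>) \<gamma>"
proof -
  let ?t = "payment (mech lo up \<gamma>)"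
  have total: "(\<Sum>j\<in>UNIV. \<gamma> * v $ j - slack (lo $ j) (up $ j) \<gamma>) = \<gamma> * (1 \<bullet> v)" for v
    using root phi_eq_sum_slack[OF up \<gamma>, of lo]
    by (simp add: sum_subtractf one_inner_vec flip: sum_distrib_left)
  have pos: "0 < 1 \<bullet> v" if "v \<in> cbox lo up" for v
    unfolding one_inner_vec using that bounds lo
    by (intro sum_vec_pos[of lo]) (auto simp: mem_box_cart)
  have up_mem: "up \<in> cbox lo up"
    using bounds by (simp add: mem_box_cart)
  have "?t up = \<gamma> * (1 \<bullet> up)"
    unfolding total[symmetric] using up \<gamma> by (simp add: mech_def pay_component_upper)
  then have "\<gamma> = ?t up / (1 \<bullet> up)"
    using pos[OF up_mem] by simp
  moreover have "\<gamma> \<le> ?t v / (1 \<bullet> v)" if "v \<in> cbox lo up" for v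
  proof -
    have "\<gamma> * (1 \<bullet> v) \<le> ?t v"
      unfolding total[symmetric] using up \<gamma>
      by (auto simp: mech_def intro!: sum_mono pay_component_ge)
    then show ?thesis
      using pos[OF that] by (simp add: pos_le_divide_eq)
  qed
  ultimately show ?thesis
    using up_mem unfolding achieves_approximation_ratio_def is_minimum_def by blast
qed

lemma phi_root_exists:
  fixes lo up :: "real ^ 'n::finite"
  assumes bounds: "\<forall>j. 0 \<le> lo $ j \<and> lo $ j \<le> up $ j"
    and up: "\<forall>j. 0 < up $ j"
    and lo: "0 < Max (range (\<lambda>j. lo $ j))"
  shows "\<exists>\<gamma>\<in>{0<..1}. phi lo up \<gamma> = 0"
proof -
  \<comment> \<open>The bound \<open>\<gamma> * U - L\<close> on the sum of slacks vanishes at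
    \<open>L / U\<close>, which gives a positive left endpoint for the intermediate value
    theorem.\<close>
  define L U where "L = (\<Sum>j\<in>UNIV. lo $ j)" and "U = (\<Sum>j\<in>UNIV. up $ j)"
  have "0 < L"
    unfolding L_def using bounds lo by (intro sum_vec_pos[of lo]) auto
  moreover have "L \<le> U"
    unfolding L_def U_def using bounds by (intro sum_mono) auto
  ultimately have \<delta>: "0 < L / U" "L / U \<le> 1"
    by auto
  let ?f = "\<lambda>\<gamma>. \<Sum>j\<in>UNIV. slack (lo $ j) (up $ j) \<gamma>"
  have "?f (L / U) \<le> (\<Sum>j\<in>UNIV. L / U * up $ j - lo $ j)"
    using up \<delta> by (intro sum_mono slack_le) auto
  also have "\<dots> = L / U * U - L"
    unfolding L_def U_def by (simp only: sum_subtractf sum_distrib_left)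
  also have "\<dots> = 0"
    using \<delta> by auto
  finally have "?f (L / U) \<le> 0" .
  moreover have "0 \<le> ?f 1"
    using bounds up by (intro sum_nonneg slack_one_nonneg) auto
  moreover have "continuous_on {L / U..1} ?f"
    using up \<delta> by (intro continuous_on_sum continuous_on_subset[OF continuous_on_slack]) auto
  ultimately obtain \<gamma> where \<gamma>: "L / U \<le> \<gamma>" "\<gamma> \<le> 1" "?f \<gamma> = 0"
    using IVT'[of ?f "L / U" 0 1] \<delta> by auto
  then have "0 < \<gamma>"
    using \<delta> by linarith
  then show ?thesis
    using \<gamma> phi_eq_sum_slack[OF up] by (intro bexI[of _ \<gamma>]) auto
qed

lemma phi_strict_mono:
  fixes lo up :: "real ^ 'n::finite"
  assumes "\<forall>j. lo $ j \<le> up $ j" "\<forall>j. 0 < up $ j" "0 < \<gamma>" "\<gamma> < \<gamma>'"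
  shows "phi lo up \<gamma> < phi lo up \<gamma>'"
  using assms
  by (auto simp: phi_eq_sum_slack intro!: sum_strict_mono slack_strict_mono)

theorem proposition1:
  fixes lo up :: "real ^ 'n::finite"
  assumes "\<forall>j. 0 \<le> lo $ j \<and> lo $ j \<le> up $ j"
    and "\<forall>j. 0 < up $ j"
    and "0 < Max (range (\<lambda>j. lo $ j))"
  shows "(\<exists>!\<gamma>. \<gamma> \<in> {0<..1} \<and> phi lo up \<gamma> = 0) \<and>
         (\<forall>\<gamma>. \<gamma> \<in> {0<..1} \<and> phi lo up \<gamma> = 0 \<longrightarrow>
            achieves_approximation_ratio lo up (mech lo up \<gamma>) \<gamma>)"
proof -
  have unique: "\<gamma> = \<gamma>'"
    if "0 < \<gamma>" "0 < \<gamma>'" "phi lo up \<gamma> = 0" "phi lo up \<gamma>' = 0" for \<gamma> \<gamma>'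
    using that assms phi_strict_mono[of lo up \<gamma> \<gamma>'] phi_strict_mono[of lo up \<gamma>' \<gamma>]
    by (cases \<gamma> \<gamma>' rule: linorder_cases) auto
  show ?thesis
    using phi_root_exists[OF assms] mech_achieves_root[OF assms] unique by auto
qed

end
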